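(* Let $n\ge1$ and $b\in H^s(T^n)$ with $s\in\mathbb{R}$. Let $u$ be the solution of the classical diffusion equation $u_t=\Delta u+b$ on $T^n$ with initial condition $u|_{t=0}=0$. For any $\delta>0$, let $u^{\delta,\beta}$ be the solution of the nonlocal diffusion equation $$u^{\delta,\beta}_t(x,t)=L^{\delta,\beta}u^{\delta,\beta}(x,t)+b(x),\ x\in T^n,\ t>0,\qquad u^{\delta,\beta}(x,0)=0,\ x\in T^n.$$ Then, for $t>0$ and $\beta\le n$, $$\lim_{\delta\to0^+}u^{\delta,\beta}(\cdot,t)=u(\cdot,t)\quad\text{in }H^s(T^n),$$ and for $t>0$ and $n<\beta\le n+2$, $$\lim_{\delta\to0^+}u^{\delta,\beta}(\cdot,t)=u(\cdot,t)\quad\text{in }H^{s+\beta-n}(T^n).$$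
   Context: Let $r_1,\dots,r_n>0$ and let $T^n=\prod_{i=1}^n[0,r_i]$ be the periodic torus (opposite faces identified). For $k\in\mathbb{Z}^n$ put $\nu_k=\left(\frac{2\pi k_1}{r_1},\dots,\frac{2\pi k_n}{r_n}\right)$. A periodic distribution $h$ on $T^n$ is written through its Fourier coefficients as $h=\sum_{k\in\mathbb{Z}^n}\hat h_k e^{i\nu_k\cdot x}$. For $s\in\mathbb{R}$, $H^s(T^n)$ is the space of periodic distributions with $\|h\|_{H^s(T^n)}^2:=\sum_{k\in\mathbb{Z}^n}(1+\|k\|^2)^s|\hat h_k|^2<\infty$. For $n\ge1$, $\delta>0$, $\beta<n+4$, the Fourier multiplier is $$m^{\delta,\beta}(\nu)=-\|\nu\|^2\;{}_2F_3\!\left(1,\tfrac{n+2-\beta}{2};\,2,\tfrac{n+2}{2},\tfrac{n+4-\beta}{2};\,-\tfrac14\|\nu\|^2\delta^2\right),\quad \nu\in\mathbb{R}^n.$$ For $\beta<n+2$ it equals $c^{\delta,\beta}\int_{B_\delta(0)}\frac{\cos(\nu\cdot z)-1}{\|z\|^\beta}dz$ with $c^{\delta,\beta}=\frac{2(n+2-\beta)\Gamma(\frac n2+1)}{\pi^{n/2}\delta^{n+2-\beta}}$; for $\beta=n+2$ it equals $-\|\nu\|^2$. The operator $L^{\delta,\beta}$ acts by $L^{\delta,\beta}J=\sum_{k}m^{\delta,\beta}(\nu_k)\hat J_k e^{i\nu_k\cdot x}$. The solutions have Fourier coefficients, for $k\ne0$, $\hat u^{\delta,\beta}_k(t)=\frac{e^{m^{\delta,\beta}(\nu_k)t}-1}{m^{\delta,\beta}(\nu_k)}\hat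 b_k$ and $\hat u_k(t)=\frac{e^{-\|\nu_k\|^2t}-1}{-\|\nu_k\|^2}\hat b_k$, and for $k=0$ both equal $\hat b_0t$. *)

theory Defs
  imports "HOL-Analysis.Analysis"
begin

section \<open>Periodic test functions\<close>

text \<open>The torus with side lengths \<open>r $ i\<close> is represented by functions on \<open>real ^ 'n\<close> that are
  \<open>r $ i\<close>-periodic in the \<open>i\<close>-th coordinate; the dimension is \<open>CARD('n)\<close>.\<close>

definition partial :: "'n \<Rightarrow> (real ^ 'n \<Rightarrow> complex) \<Rightarrow> real ^ 'n \<Rightarrow> complex"
  where "partial i \<phi> x = frechet_derivative \<phi> (at x) (axis i 1)"

fun partials :: "'n list \<Rightarrow> (real ^ 'n \<Rightarrow> complex) \<Rightarrow> real ^ 'n \<Rightarrow> complex" where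
  "partials [] \<phi> = \<phi>"
| "partials (i # is) \<phi> = partial i (partials is \<phi>)"

definition smooth :: "(real ^ 'n \<Rightarrow> complex) \<Rightarrow> bool"
  where "smooth \<phi> \<longleftrightarrow> (\<forall>is x. partials is \<phi> differentiable (at x))"

definition test_functions :: "real ^ 'n \<Rightarrow> (real ^ 'n \<Rightarrow> complex) set"
  where "test_functions r = {\<phi>. smooth \<phi> \<and> (\<forall>i x. \<phi> (x + axis i (r $ i)) = \<phi> x)}"

definition laplacian :: "(real ^ 'n \<Rightarrow> complex) \<Rightarrow> real ^ 'n \<Rightarrow> complex"
  where "laplacian \<phi> x = (\<Sum>i\<in>UNIV. partials [i, i] \<phi> x)"

definition C_norm :: "nat \<Rightarrow> (real ^ 'n \<Rightarrow> complex) \<Rightarrow> real"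
  where "C_norm N \<phi> = (\<Sum>is | length is \<le> N. SUP x. norm (partials is \<phi> x))"


section \<open>Periodic distributions and their Fourier coefficients\<close>

text \<open>A distribution is a functional on test functions. Its values outside of the space of test
  functions are irrelevant, so equations between distributions are only ever stated on test
  functions. A function \<open>f\<close> on the torus is identified with the distribution
  \<open>\<phi> \<mapsto> \<integral> f \<phi>\<close>, without complex conjugation.\<close>

type_synonym 'n functional = "((real, 'n) vec \<Rightarrow> complex) \<Rightarrow> complex"

definition periodic_distribution :: "real ^ 'n \<Rightarrow> 'n functional \<Rightarrow> bool" where
  "periodic_distribution r h \<longleftrightarrow>
     (\<forall>\<phi>\<in>test_functions r. \<forall>\<psi>\<in>test_functions r. h (\<lambda>x. \<phi> x + \<psi> x) = h \<phi> + h \<psi>) \<and>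
     (\<forall>c. \<forall>\<phi>\<in>test_functions r. h (\<lambda>x. c * \<phi> x) = c * h \<phi>) \<and>
     (\<exists>C N. \<forall>\<phi>\<in>test_functions r. norm (h \<phi>) \<le> C * C_norm N \<phi>)"

definition freq :: "real ^ 'n \<Rightarrow> int ^ 'n \<Rightarrow> real ^ 'n"
  where "freq r k = (\<chi> i. 2 * pi * of_int (k $ i) / r $ i)"

definition fourier_coeff :: "real ^ 'n \<Rightarrow> 'n functional \<Rightarrow> int ^ 'n \<Rightarrow> complex"
  where "fourier_coeff r h k = h (\<lambda>x. cis (- (freq r k \<bullet> x))) / of_real (\<Prod>i\<in>UNIV. r $ i)"


section \<open>Sobolev spaces\<close>

definition sobolev_term :: "real ^ 'n \<Rightarrow> real \<Rightarrow> 'n functional \<Rightarrow> int ^ 'n \<Rightarrow> real" where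
  "sobolev_term r s h k =
     (1 + (norm (\<chi> i. real_of_int (k $ i)))\<^sup>2) powr s * (norm (fourier_coeff r h k))\<^sup>2"

definition sobolev :: "real ^ 'n \<Rightarrow> real \<Rightarrow> 'n functional set"
  where "sobolev r s = {h. periodic_distribution r h \<and> sobolev_term r s h summable_on UNIV}"

definition sobolev_norm :: "real ^ 'n \<Rightarrow> real \<Rightarrow> 'n functional \<Rightarrow> real"
  where "sobolev_norm r s h = sqrt (\<Sum>\<^sub>\<infinity>k. sobolev_term r s h k)"

definition sobolev_tendsto ::
  "real ^ 'n \<Rightarrow> real \<Rightarrow> ('a \<Rightarrow> 'n functional) \<Rightarrow> 'n functional \<Rightarrow> 'a filter \<Rightarrow> bool" where
  "sobolev_tendsto r s f h F \<longleftrightarrow>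
     h \<in> sobolev r s \<and> (\<forall>\<^sub>F a in F. f a \<in> sobolev r s) \<and>
     ((\<lambda>a. sobolev_norm r s (\<lambda>\<phi>. f a \<phi> - h \<phi>)) \<longlongrightarrow> 0) F"


section \<open>The local and the nonlocal Laplace operator\<close>

definition hypergeometric :: "real list \<Rightarrow> real list \<Rightarrow> real \<Rightarrow> real" where
  "hypergeometric as bs z =
     (\<Sum>j. prod_list (map (\<lambda>a. pochhammer a j) as) / prod_list (map (\<lambda>b. pochhammer b j) bs)
            * z ^ j / fact j)"

definition multiplier :: "real \<Rightarrow> real \<Rightarrow> real ^ 'n \<Rightarrow> real" where
  "multiplier \<delta> \<beta> \<nu> = (let n = real CARD('n) in
     - (norm \<nu>)\<^sup>2 *
       hypergeometric [1, (n + 2 - \<beta>) / 2] [2, (n + 2) / 2, (n + 4 - \<beta>) / 2]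
         (- (1/4) * (norm \<nu>)\<^sup>2 * \<delta>\<^sup>2))"

text \<open>\<open>nonlocal r \<delta> \<beta> J\<close> is the Fourier series \<open>\<Sum>k. m(\<nu>\<^sub>k) J\<^sub>k exp (i \<nu>\<^sub>k \<bullet> x)\<close>, summed in the
  sense of distributions.\<close>

definition nonlocal :: "real ^ 'n \<Rightarrow> real \<Rightarrow> real \<Rightarrow> 'n functional \<Rightarrow> 'n functional" where
  "nonlocal r \<delta> \<beta> J \<phi> =
     (\<Sum>\<^sub>\<infinity>k. of_real (multiplier \<delta> \<beta> (freq r k)) * fourier_coeff r J k *
            integral (cbox 0 r) (\<lambda>x. cis (freq r k \<bullet> x) * \<phi> x))"

definition distr_laplacian :: "('n::finite) functional \<Rightarrow> 'n functional"
  where "distr_laplacian h \<phi> = h (laplacian \<phi>)"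


section \<open>Diffusion equations with zero initial data\<close>

text \<open>\<open>u\<close> is a distribution-valued solution of \<open>u\<^sub>t = A u + b\<close> for \<open>t > 0\<close>, with \<open>u = 0\<close> at
  \<open>t = 0\<close>; continuity and the time derivative are those of the weak-* topology.\<close>

definition diffusion_solution ::
  "real ^ 'n \<Rightarrow> ('n functional \<Rightarrow> 'n functional) \<Rightarrow> 'n functional \<Rightarrow> (real \<Rightarrow> 'n functional) \<Rightarrow> bool"
  where
  "diffusion_solution r A b u \<longleftrightarrow>
     (\<forall>t\<ge>0. periodic_distribution r (u t)) \<and>
     (\<forall>\<phi>\<in>test_functions r.
        u 0 \<phi> = 0 \<and> continuous_on {0..} (\<lambda>t. u t \<phi>) \<and>
        (\<forall>t>0. ((\<lambda>t. u t \<phi>) has_vector_derivative A (u t) \<phi> + b \<phi>) (at t)))"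

end

theory Submission
  imports Defs
begin

text \<open>Testing both equations with \<open>exp (-i \<nu>\<^sub>k \<bullet> x)\<close> decouples them into scalar linear equations, so each
  Fourier coefficient of a solution at time \<open>t\<close> is \<open>(exp (m t) - 1) / m\<close> times that of \<open>b\<close>, with
  \<open>m\<close> the multiplier of the operator. As \<open>\<delta> \<rightarrow> 0\<close> the multipliers converge for every fixed \<open>k\<close>, and
  the theorem is dominated convergence over \<open>k\<close>. The dominating bound is \<open>\<bar>exp (m t) - 1\<bar> / \<bar>m\<bar> \<le> t\<close>
  if \<open>\<beta> \<le> n\<close>, which needs only \<open>m \<le> 0\<close>, and \<open>\<le> 1 / \<bar>m\<bar>\<close> if \<open>\<beta> > n\<close>, which needs
  \<open>\<bar>m\<bar> \<ge> C \<parallel>\<nu>\<parallel> powr (\<beta> - n)\<close> uniformly in \<open>\<delta>\<close>.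

  With \<open>a = (n + 2 - \<beta>) / 2\<close>, write \<open>F\<close> for the \<open>\<^sub>2F\<^sub>3\<close> of the multiplier and \<open>G\<close> for the \<open>\<^sub>1F\<^sub>2\<close> that
  results from cancelling \<open>a\<close> against \<open>a + 1\<close>. Then \<open>z F' + a F = a G\<close>, and \<open>G(-y)\<close> is a positive
  multiple of \<open>(1 - L(y)) / y\<close> for a normalised Bessel function \<open>L \<le> 1\<close>. Hence \<open>y\<^sup>a F(-y)\<close> is
  nondecreasing, which bounds \<open>F(-y)\<close> from below by a multiple of \<open>(1 + y) powr (-a)\<close>.\<close>

section \<open>The hypergeometric series\<close>

definition hypergeometric_coeff :: "real list \<Rightarrow> real list \<Rightarrow> nat \<Rightarrow> real" where
  "hypergeometric_coeff as bs j =
     prod_list (map (\<lambda>a. pochhammer a j) as) / prod_list (map (\<lambda>b. pochhammer b j) bs) / fact j"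

lemma hypergeometric_eq_powser:
  "hypergeometric as bs z = (\<Sum>j. hypergeometric_coeff as bs j * z ^ j)"
  unfolding hypergeometric_def hypergeometric_coeff_def by simp

lemma hypergeometric_at_0: "hypergeometric as bs 0 = 1"
proof -
  have "prod_list (map (\<lambda>a. pochhammer a 0) xs) = 1" for xs :: "real list"
    by (induction xs) auto
  then show ?thesis
    unfolding hypergeometric_eq_powser powser_zero hypergeometric_coeff_def by simp
qed

lemma summable_powser_if_le_inverse_fact:
  fixes c :: "nat \<Rightarrow> real"
  assumes "\<And>j. \<bar>c j\<bar> \<le> C / fact j"
  shows "summable (\<lambda>j. c j * z ^ j)"
proof (rule summable_comparison_test')
  show "summable (\<lambda>j. C * (inverse (fact j) * \<bar>z\<bar> ^ j))"
    by (intro summable_mult summable_exp)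
  fix j :: nat
  have "\<bar>c j\<bar> * \<bar>z\<bar> ^ j \<le> C / fact j * \<bar>z\<bar> ^ j"
    by (intro mult_right_mono assms) auto
  then show "norm (c j * z ^ j) \<le> C * (inverse (fact j) * \<bar>z\<bar> ^ j)"
    by (simp add: abs_mult power_abs field_simps)
qed

text \<open>The Euler operator \<open>z d/dz\<close> multiplies the \<open>j\<close>-th coefficient
  by \<open>j\<close>. This turns the differential equations below into coefficient
  recursions.\<close>

lemma powser_euler_operator_sums:
  fixes c :: "nat \<Rightarrow> real"
  assumes "\<And>z. summable (\<lambda>j. c j * z ^ j)"
  shows "(\<lambda>j. real j * c j * z ^ j) sums (z * (\<Sum>j. diffs c j * z ^ j))"
proof -
  have "summable (\<lambda>j. diffs c j * z ^ j)"
    by (rule termdiff_converges_all) (use assms in auto)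
  then have "(\<lambda>j. z * (real j * c j * z ^ (j - Suc 0))) sums (z * (\<Sum>j. diffs c j * z ^ j))"
    by (intro sums_mult diffs_equiv)
  moreover have "z * (real j * c j * z ^ (j - Suc 0)) = real j * c j * z ^ j" for j
    by (cases j) auto
  ultimately show ?thesis by simp
qed

section \<open>Pochhammer symbols\<close>

lemma pochhammer_ge_1: "1 \<le> (x::real) \<Longrightarrow> 1 \<le> pochhammer x j"
  by (simp add: pochhammer_prod prod_ge_1)

lemma pochhammer_ge_self:
  assumes "0 < (x::real)" "x \<le> 1"
  shows "x \<le> pochhammer x j"
proof (cases j)
  case (Suc m)
  then show ?thesis
    using pochhammer_ge_1[of "x + 1" m] assms by (simp add: pochhammer_rec)
qed (use assms in auto)

text \<open>Both sides are \<open>pochhammer x (Suc j)\<close>. This is the cancellation of an upper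
  parameter \<open>x\<close> against a lower parameter \<open>x + 1\<close>.\<close>

lemma pochhammer_shift:
  "(x + real j) * pochhammer x j = x * pochhammer (x + 1) j"
  using pochhammer_rec[of x j] pochhammer_Suc[of x j] by (simp add: mult.commute)

text \<open>The function \<open>y \<mapsto> \<^sub>0F\<^sub>1(;c;-y)\<close> is a rescaled Bessel function. It solves
  \<open>y L'' + c L' + L = 0\<close>, so \<open>L\<^sup>2 + y L'\<^sup>2\<close> has derivative \<open>(1 - 2 c) L'\<^sup>2\<close>.\<close>

lemma hypergeometric_0F1_le_1:
  fixes c y :: real
  assumes c: "1/2 \<le> c" and y: "0 \<le> y"
  shows "hypergeometric [] [c] (- y) \<le> 1"
proof -
  define l where "l = hypergeometric_coeff [] [c]"
  have pos: "0 < pochhammer c j" for j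
    using c by (intro pochhammer_pos) auto
  \<comment> \<open>The 2 comes from \<open>pochhammer c j \<ge> 1/2\<close>; for
    \<open>c < 1\<close> the lower bound used is \<open>c\<close> itself.\<close>
  have "\<bar>l j\<bar> \<le> 2 / fact j" for j
  proof -
    have "1/2 \<le> pochhammer c j"
      using pochhammer_ge_1[of c j] pochhammer_ge_self[of c j] c by (cases "c \<le> 1") auto
    with pos[of j] show ?thesis
      by (simp add: l_def hypergeometric_coeff_def field_simps)
  qed
  then have sl: "summable (\<lambda>j. l j * z ^ j)" for z
    by (rule summable_powser_if_le_inverse_fact)
  have sd: "summable (\<lambda>j. diffs l j * z ^ j)" for z
    by (rule termdiff_converges_all) (use sl in auto)
  define L where "L y = (\<Sum>j. l j * (- y) ^ j)" for y
  define D where "D y = (\<Sum>j. diffs l j * (- y) ^ j)" for y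
  define D2 where "D2 y = (\<Sum>j. diffs (diffs l) j * (- y) ^ j)" for y
  have dL: "(L has_real_derivative - D y) (at y)" for y
    unfolding L_def D_def
    using DERIV_chain2[OF termdiffs_strong_converges_everywhere[OF sl], of uminus "-1" y]
    by (simp add: DERIV_minus)
  have dD: "(D has_real_derivative - D2 y) (at y)" for y
    unfolding D_def D2_def
    using DERIV_chain2[OF termdiffs_strong_converges_everywhere[OF sd], of uminus "-1" y]
    by (simp add: DERIV_minus)
  \<comment> \<open>Since \<open>D\<close> is \<open>- L'\<close> and \<open>D2\<close> is
    \<open>L''\<close>, this is the Bessel-type equation. In coefficients it reads
    \<open>(c + j) (j + 1) l (j + 1) = l j\<close>.\<close>
  have ode: "- y * D2 y + c * D y = L y" for y
  proof -
    have "(\<lambda>j. real j * diffs l j * (- y) ^ j + c * (diffs l j * (- y) ^ j)) sums (- y * D2 y + c * D y)"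
      unfolding D_def D2_def
      by (intro sums_add powser_euler_operator_sums sd sums_mult summable_sums)
    moreover have "real j * diffs l j * (- y) ^ j + c * (diffs l j * (- y) ^ j) = l j * (- y) ^ j" for j
    proof -
      have "(c + real j) * diffs l j = l j"
      proof -
        have "c + real j \<noteq> 0" using c by auto
        then show ?thesis
          by (simp add: diffs_def l_def hypergeometric_coeff_def pochhammer_Suc)
      qed
      then have "((c + real j) * diffs l j) * (- y) ^ j = l j * (- y) ^ j" by simp
      then show ?thesis by (simp only: distrib_right mult.assoc add.commute)
    qed
    ultimately have "(\<lambda>j. l j * (- y) ^ j) sums (- y * D2 y + c * D y)" by simp
    then show ?thesis by (simp add: L_def sums_iff)
  qed
  define E where "E y = (L y)\<^sup>2 + y * (D y)\<^sup>2" for y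
  have "E y \<le> E 0"
  proof (rule DERIV_nonpos_imp_nonincreasing[OF y])
    fix x
    have "(E has_real_derivative 2 * L x * (- D x) + ((D x)\<^sup>2 + x * (2 * D x * (- D2 x)))) (at x)"
      unfolding E_def
      by (rule derivative_eq_intros dL dD refl)+ simp
    moreover have "2 * L x * (- D x) + ((D x)\<^sup>2 + x * (2 * D x * (- D2 x))) = (1 - 2 * c) * (D x)\<^sup>2"
      unfolding ode[of x, symmetric] by (simp add: algebra_simps power2_eq_square)
    moreover have "(1 - 2 * c) * (D x)\<^sup>2 \<le> 0"
      using c by (simp add: mult_nonpos_nonneg)
    ultimately show "\<exists>y. (E has_real_derivative y) (at x) \<and> y \<le> 0"
      by metis
  qed
  moreover have "E 0 = 1"
    using hypergeometric_at_0[of "[]" "[c]"]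
    by (simp add: E_def L_def l_def hypergeometric_eq_powser)
  ultimately have "(L y)\<^sup>2 \<le> 1"
    using y by (simp add: E_def) (smt (verit) zero_le_mult_iff zero_le_power2)
  then have "L y \<le> 1"
    by (simp add: abs_square_le_1)
  then show ?thesis
    by (simp add: L_def l_def hypergeometric_eq_powser)
qed

text \<open>Shifting the index of the series of \<open>L(y) = hypergeometric [] [c] (- y)\<close> by
  one shows that the value here is \<open>c (1 - L(y)) / y\<close>, so the bound
  \<open>L(y) \<le> 1\<close> applies.\<close>

lemma hypergeometric_1F2_nonneg:
  fixes c y :: real
  assumes c: "1/2 \<le> c" and y: "0 < y"
  shows "0 \<le> hypergeometric [1] [2, c + 1] (- y)"
proof -
  let ?l = "hypergeometric_coeff [] [c]" and ?g = "hypergeometric_coeff [1] [2, c + 1]"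
  have eq: "?g j = c * ?l (Suc j)" for j
  proof -
    have "pochhammer 2 j = (fact (Suc j) :: real)"
      using pochhammer_rec[of "1::real" j] by (simp add: pochhammer_fact)
    then show ?thesis
      using c by (simp add: hypergeometric_coeff_def pochhammer_rec pochhammer_fact[symmetric])
  qed
  have le: "\<bar>?l (Suc j)\<bar> \<le> 2 / fact j" for j
  proof -
    have "1 \<le> pochhammer (c + 1) j" using c by (intro pochhammer_ge_1) auto
    then have "1/2 * 1 \<le> c * pochhammer (c + 1) j" using c by (intro mult_mono) auto
    moreover have "fact j \<le> (fact (Suc j) :: real)" by (intro fact_mono) auto
    ultimately have "1/2 * fact j \<le> c * pochhammer (c + 1) j * (fact (Suc j) :: real)"
      by (intro mult_mono) auto
    then show ?thesis using c \<open>1 \<le> pochhammer (c + 1) j\<close>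
      by (simp add: hypergeometric_coeff_def pochhammer_rec divide_simps abs_mult mult_ac)
  qed
  have sm: "summable (\<lambda>j. ?l (Suc j) * (- y) ^ j)"
    by (rule summable_powser_if_le_inverse_fact[OF le])
  have "hypergeometric [1] [2, c + 1] (- y) = c * (\<Sum>j. ?l (Suc j) * (- y) ^ j)"
    using sm by (simp add: hypergeometric_eq_powser eq suminf_mult mult.assoc)
  moreover have "hypergeometric [] [c] (- y) = 1 + (- y) * (\<Sum>j. ?l (Suc j) * (- y) ^ j)"
  proof -
    have "(\<lambda>j. ?l (Suc j) * (- y) ^ Suc j) sums (- y * (\<Sum>j. ?l (Suc j) * (- y) ^ j))"
      using sums_mult[OF summable_sums[OF sm], of "- y"] by (simp add: mult_ac)
    then have "(\<lambda>j. ?l j * (- y) ^ j) sums (- y * (\<Sum>j. ?l (Suc j) * (- y) ^ j) + ?l 0 * (- y) ^ 0)"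
      by (subst (asm) sums_Suc_iff) simp
    then show ?thesis
      by (simp add: hypergeometric_eq_powser sums_iff hypergeometric_coeff_def)
  qed
  ultimately show ?thesis
    using hypergeometric_0F1_le_1[OF c, of y] c y by (simp add: zero_le_mult_iff)
qed

section \<open>The series of the multiplier and its lower bound\<close>

lemma multiplier_series_derivative:
  fixes a c :: real
  assumes a: "0 \<le> a" and c: "0 \<le> c"
  obtains F' where "\<And>z. (hypergeometric [1, a] [2, c + 1, a + 1] has_real_derivative F' z) (at z)"
    and "\<And>z. z * F' z + a * hypergeometric [1, a] [2, c + 1, a + 1] z
           = a * hypergeometric [1] [2, c + 1] z"
proof -
  let ?f = "hypergeometric_coeff [1, a] [2, c + 1, a + 1]" and ?g = "hypergeometric_coeff [1] [2, c + 1]"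
  have p: "1 \<le> pochhammer (c + 1) j" "1 \<le> pochhammer (2::real) j" "1 \<le> pochhammer (a + 1) j"
    "1 \<le> pochhammer (1::real) j" "0 \<le> pochhammer a j" for j
    using a c by (auto intro!: pochhammer_ge_1) (auto simp: pochhammer_prod intro!: prod_nonneg)
  \<comment> \<open>The undivided form also covers \<open>a = 0\<close>, that is \<beta> = n + 2: at
    \<open>j = 0\<close> both sides vanish although \<open>?f 0 = 1\<close>.\<close>
  have rec: "(a + real j) * ?f j = a * ?g j" for j
    using p[of j] pochhammer_shift[of a j]
    by (simp add: hypergeometric_coeff_def divide_simps mult_ac)
  have g: "\<bar>?g j\<bar> \<le> 1 / fact j" for j
  proof -
    have "pochhammer 1 j \<le> pochhammer (2::real) j"
      using pochhammer_shift[of 1 j] p[of j] by (smt (verit) mult_le_cancel_right1 mult_right_mono of_nat_0_le_iff one_add_one)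
    then have "pochhammer 1 j * 1 \<le> pochhammer (2::real) j * pochhammer (c + 1) j"
      using p[of j] by (intro mult_mono) auto
    then show ?thesis using p[of j] by (simp add: hypergeometric_coeff_def divide_simps)
  qed
  have f: "\<bar>?f j\<bar> \<le> 1 / fact j" for j
  proof -
    have fg: "?f j = pochhammer a j / pochhammer (a + 1) j * ?g j"
      by (simp add: hypergeometric_coeff_def mult_ac)
    have "pochhammer a j \<le> pochhammer (a + 1) j"
      using a by (auto simp: pochhammer_prod intro!: prod_mono)
    then have "\<bar>pochhammer a j / pochhammer (a + 1) j\<bar> \<le> 1"
      using p[of j] by simp
    then have "\<bar>?f j\<bar> \<le> 1 * \<bar>?g j\<bar>"
      unfolding fg abs_mult by (intro mult_right_mono) auto
    then show ?thesis using g[of j] by simp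
  qed
  have sf: "summable (\<lambda>j. ?f j * z ^ j)" for z
    by (rule summable_powser_if_le_inverse_fact[OF f])
  have sg: "summable (\<lambda>j. ?g j * z ^ j)" for z
    by (rule summable_powser_if_le_inverse_fact[OF g])
  have F: "hypergeometric [1, a] [2, c + 1, a + 1] = (\<lambda>z. \<Sum>j. ?f j * z ^ j)"
    by (rule ext) (rule hypergeometric_eq_powser)
  show ?thesis
  proof
    show "(hypergeometric [1, a] [2, c + 1, a + 1] has_real_derivative (\<Sum>j. diffs ?f j * z ^ j)) (at z)" for z
      unfolding F by (rule termdiffs_strong_converges_everywhere[OF sf])
    fix z
    have "(\<lambda>j. real j * ?f j * z ^ j + a * (?f j * z ^ j)) sums
          (z * (\<Sum>j. diffs ?f j * z ^ j) + a * (\<Sum>j. ?f j * z ^ j))"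
      by (intro sums_add powser_euler_operator_sums sf sums_mult summable_sums)
    moreover have "real j * ?f j * z ^ j + a * (?f j * z ^ j) = a * (?g j * z ^ j)" for j
    proof -
      have "((a + real j) * ?f j) * z ^ j = a * ?g j * z ^ j" by (simp only: rec)
      then show ?thesis by (simp only: distrib_right mult.assoc add.commute)
    qed
    moreover have "(\<lambda>j. a * (?g j * z ^ j)) sums (a * hypergeometric [1] [2, c + 1] z)"
      unfolding hypergeometric_eq_powser by (intro sums_mult summable_sums sg)
    ultimately show "z * (\<Sum>j. diffs ?f j * z ^ j) + a * hypergeometric [1, a] [2, c + 1, a + 1] z
           = a * hypergeometric [1] [2, c + 1] z"
      unfolding F by (simp add: sums_iff)
  qed
qed

text \<open>The weight \<open>y\<^sup>a\<close> turns \<open>z F' + a F = a G\<close> into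
  \<open>(y\<^sup>a F(-y))' = a y\<^bsup>a - 1\<^esup> G(-y) \<ge> 0\<close>.\<close>

lemma powr_mult_multiplier_series_mono:
  fixes a c x y :: real
  assumes a: "0 \<le> a" and c: "1/2 \<le> c" and xy: "0 < x" "x \<le> y"
  shows "x powr a * hypergeometric [1, a] [2, c + 1, a + 1] (- x)
       \<le> y powr a * hypergeometric [1, a] [2, c + 1, a + 1] (- y)"
proof -
  let ?F = "hypergeometric [1, a] [2, c + 1, a + 1]"
  obtain F' where F': "\<And>z. (?F has_real_derivative F' z) (at z)"
    and eq: "\<And>z. z * F' z + a * ?F z = a * hypergeometric [1] [2, c + 1] z"
    by (rule multiplier_series_derivative[of a c]) (use a c in auto)
  show ?thesis
  proof (rule DERIV_nonneg_imp_nondecreasing[OF xy(2)])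
    fix t assume "x \<le> t" "t \<le> y"
    then have t: "0 < t" using xy by auto
    have "((\<lambda>t. t powr a * ?F (- t)) has_real_derivative
            a * t powr (a - 1) * ?F (- t) + t powr a * (- F' (- t))) (at t)"
      by (rule derivative_eq_intros DERIV_chain2[OF F'] refl t | simp)+
    moreover have "a * t powr (a - 1) * ?F (- t) + t powr a * (- F' (- t))
        = t powr (a - 1) * (a * hypergeometric [1] [2, c + 1] (- t))"
    proof -
      have "t powr a = t powr (a - 1) * t" using t by (simp add: powr_diff)
      then show ?thesis unfolding eq[of "- t", symmetric] by (simp add: algebra_simps)
    qed
    moreover have "0 \<le> t powr (a - 1) * (a * hypergeometric [1] [2, c + 1] (- t))"
      using a hypergeometric_1F2_nonneg[OF c t] by simp
    ultimately show "\<exists>y. ((\<lambda>t. t powr a * ?F (- t)) has_real_derivative y) (at t) \<and> 0 \<le> y"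
      by metis
  qed
qed

text \<open>Near 0 the series exceeds 1/2 by continuity. From a point \<open>y0\<close> on,
  monotonicity of \<open>y powr a * F(-y)\<close> carries the value at \<open>y0\<close> to all
  larger \<open>y\<close>, with decay no faster than \<open>y powr (- a)\<close>.\<close>

lemma multiplier_series_lower_bound:
  fixes a c :: real
  assumes a: "0 \<le> a" and c: "1/2 \<le> c"
  obtains \<kappa> where "0 < \<kappa>"
    "\<And>y. 0 \<le> y \<Longrightarrow> \<kappa> * (1 + y) powr (- a) \<le> hypergeometric [1, a] [2, c + 1, a + 1] (- y)"
proof -
  let ?F = "hypergeometric [1, a] [2, c + 1, a + 1]"
  obtain F' where F': "\<And>z. (?F has_real_derivative F' z) (at z)"
    by (rule multiplier_series_derivative[of a c]) (use a c in auto)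
  have "isCont ?F 0" using F' by (rule DERIV_isCont)
  then obtain d where d: "d > 0" and near1: "\<And>z. \<bar>z\<bar> < d \<Longrightarrow> \<bar>?F z - 1\<bar> < 1/2"
    unfolding continuous_at_eps_delta hypergeometric_at_0 dist_real_def
    by (metis diff_zero half_gt_zero_iff zero_less_one)
  have half: "?F z > 1/2" if "\<bar>z\<bar> < d" for z
    using near1[OF that] unfolding abs_less_iff by linarith
  \<comment> \<open>Halving \<open>d\<close> keeps the closed interval up to \<open>y0\<close>
    inside the open neighbourhood; the cap 1 gives \<open>y0 powr a \<le> 1\<close>, so one constant
    serves both cases.\<close>
  define y0 where "y0 = min 1 (d / 2)"
  have near: "1/2 \<le> ?F (- y)" if "0 \<le> y" "y \<le> y0" for y
    using d that by (intro less_imp_le half) (simp add: y0_def)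
  have y0: "0 < y0" "y0 \<le> 1" using d by (auto simp: y0_def)
  have y0a: "y0 powr a \<le> 1" using y0 a by (simp add: powr_le1)
  show ?thesis
  proof
    show "0 < y0 powr a / 2" using y0 by simp
    fix y :: real assume y: "0 \<le> y"
    show "y0 powr a / 2 * (1 + y) powr (- a) \<le> ?F (- y)"
    proof (cases "y \<le> y0")
      case True
      have "(1 + y) powr (- a) \<le> 1" using y a powr_mono[of "- a" 0 "1 + y"] by simp
      then have "y0 powr a / 2 * (1 + y) powr (- a) \<le> 1/2 * 1"
        using y0a by (intro mult_mono) auto
      then show ?thesis using near[OF y True] by simp
    next
      case False
      then have y': "y0 \<le> y" "0 < y" using y0 by auto
      have "y0 powr a * (1/2) \<le> y0 powr a * ?F (- y0)"
        using near[of y0] y0 by (intro mult_left_mono) auto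
      also have "\<dots> \<le> y powr a * ?F (- y)"
        by (rule powr_mult_multiplier_series_mono[OF a c y0(1) y'(1)])
      finally have 1: "y powr (- a) * (y0 powr a / 2) \<le> ?F (- y)"
        using y' by (simp add: powr_minus divide_simps mult_ac)
      have "(1 + y) powr (- a) \<le> y powr (- a)"
        using y' a by (intro powr_mono2') auto
      then have "y0 powr a / 2 * (1 + y) powr (- a) \<le> y0 powr a / 2 * y powr (- a)"
        by (intro mult_left_mono) auto
      with 1 show ?thesis by (simp add: mult.commute)
    qed
  qed
qed

section \<open>Fourier modes\<close>

lemma cis_inner_has_derivative:
  "((\<lambda>x. c * cis (w \<bullet> x)) has_derivative (\<lambda>h. c * (\<i> * cis (w \<bullet> x) * of_real (w \<bullet> h)))) (at x)"
  by (auto intro!: derivative_eq_intros simp: scaleR_conv_of_real)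

lemma partial_cis_inner:
  fixes w :: "real ^ 'n"
  shows "partial i (\<lambda>x. c * cis (w \<bullet> x)) = (\<lambda>x. (\<i> * of_real (w $ i) * c) * cis (w \<bullet> x))"
  unfolding partial_def
  by (subst frechet_derivative_at[OF cis_inner_has_derivative, symmetric])
     (simp add: inner_axis fun_eq_iff)

text \<open>The value of the constant is irrelevant: a multiple of the exponential is
  differentiable, which is all that \<open>smooth\<close> asks of each iterated partial.\<close>

lemma partials_cis_inner:
  fixes w :: "real ^ 'n"
  shows "\<exists>c. partials is (\<lambda>x. cis (w \<bullet> x)) = (\<lambda>x. c * cis (w \<bullet> x))"
proof (induction "is")
  case Nil
  show ?case by (intro exI[of _ 1]) simp
next
  case (Cons i "is")
  then obtain c where "partials is (\<lambda>x. cis (w \<bullet> x)) = (\<lambda>x. c * cis (w \<bullet> x))" by blast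
  then show ?case by (auto simp: partial_cis_inner)
qed

lemma laplacian_cis_inner:
  fixes w :: "real ^ 'n"
  shows "laplacian (\<lambda>x. cis (w \<bullet> x)) = (\<lambda>x. of_real (- (norm w)\<^sup>2) * cis (w \<bullet> x))"
proof -
  have "partials [i, i] (\<lambda>x. cis (w \<bullet> x)) = (\<lambda>x. of_real (- (w $ i * w $ i)) * cis (w \<bullet> x))" for i
  proof -
    have "partial i (\<lambda>x. cis (w \<bullet> x)) = (\<lambda>x. (\<i> * of_real (w $ i)) * cis (w \<bullet> x))"
      using partial_cis_inner[of i 1 w] by simp
    then show ?thesis by (simp only: partials.simps partial_cis_inner) (simp add: fun_eq_iff mult_ac)
  qed
  moreover have "(norm w)\<^sup>2 = (\<Sum>i\<in>UNIV. w $ i * w $ i)"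
    by (simp add: power2_norm_eq_inner inner_vec_def)
  ultimately show ?thesis
    unfolding laplacian_def fun_eq_iff by (simp add: sum_distrib_right sum_negf)
qed

text \<open>The minus sign matches \<open>fourier_coeff\<close>: the pairing has no conjugation, so
  the conjugate exponential must be the test function.\<close>

definition fourier_mode :: "real ^ 'n \<Rightarrow> int ^ 'n \<Rightarrow> real ^ 'n \<Rightarrow> complex" where
  "fourier_mode r k = (\<lambda>x. cis (- (freq r k \<bullet> x)))"

lemma fourier_mode_eq: "fourier_mode r k = (\<lambda>x. cis ((- freq r k) \<bullet> x))"
  unfolding fourier_mode_def by simp

lemma cis_freq_periodic:
  fixes r :: "real ^ 'n"
  assumes "r $ i \<noteq> 0"
  shows "cis (freq r k \<bullet> (x + axis i (r $ i))) = cis (freq r k \<bullet> x)"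
proof -
  have "freq r k \<bullet> axis i (r $ i) = 2 * pi * of_int (k $ i)"
    using assms by (simp add: inner_axis freq_def)
  then show ?thesis
    by (simp add: inner_add_right cis_mult[symmetric] cis_multiple_2pi)
qed

lemma fourier_mode_test_function:
  fixes r :: "real ^ 'n"
  assumes "\<And>i. 0 < r $ i"
  shows "fourier_mode r k \<in> test_functions r"
proof -
  have "smooth (fourier_mode r k)"
    unfolding smooth_def
  proof (intro allI)
    fix "is" x
    obtain c where c: "partials is (\<lambda>x. cis ((- freq r k) \<bullet> x)) = (\<lambda>x. c * cis ((- freq r k) \<bullet> x))"
      using partials_cis_inner by blast
    show "partials is (fourier_mode r k) differentiable (at x)"
      unfolding fourier_mode_eq c
      using cis_inner_has_derivative by (rule differentiableI)
  qed
  moreover have "fourier_mode r k (x + axis i (r $ i)) = fourier_mode r k x" for i x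
    using cis_freq_periodic[of r i k x] assms[of i]
    by (simp add: fourier_mode_def cis_cnj[symmetric])
  ultimately show ?thesis by (simp add: test_functions_def)
qed

text \<open>By periodicity the integral does not change when the box is translated by \<open>h\<close> in direction
  \<open>i\<close>; for \<open>h = pi / \<bar>w $ i\<bar>\<close> the translation changes the sign of the integrand.\<close>

lemma integral_cis_inner_eq_0:
  fixes r w :: "real ^ 'n"
  assumes per: "cis (w $ i * r $ i) = 1" and w: "\<bar>w $ i\<bar> * r $ i > pi"
  shows "integral (cbox 0 r) (\<lambda>x. cis (w \<bullet> x)) = 0"
proof -
  let ?f = "\<lambda>x. cis (w \<bullet> x)"
  define h where "h = pi / \<bar>w $ i\<bar>"
  have wi: "w $ i \<noteq> 0" using w pi_gt_zero by force
  have h: "0 < h" "h < r $ i"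
    using w wi by (auto simp: h_def field_simps)
  define v where "v = axis i h"
  define p where "p = axis i (r $ i)"
  define r' where "r' = (\<chi> j. if j = i then h else r $ j)"
  have int: "?f integrable_on cbox a b" for a b
    by (intro integrable_continuous continuous_intros)
  have shift: "integral (cbox (a + c) (b + c)) ?f = cis (w \<bullet> c) * integral (cbox a b) ?f" for a b c
  proof -
    have "integral (cbox (a + c) (b + c)) ?f = integral (cbox a b) (\<lambda>x. cis (w \<bullet> c) * ?f x)"
      unfolding integral_shift_cbox_plus[symmetric]
      by (simp add: o_def inner_add_right cis_mult)
    then show ?thesis by simp
  qed
  have split: "integral (cbox a b) ?f = integral (cbox a (\<chi> j. if j = i then m else b $ j)) ?f
      + integral (cbox (\<chi> j. if j = i then m else a $ j) b) ?f"
    if "a $ i \<le> m" "m \<le> b $ i" for a b :: "real ^ 'n" and m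
  proof -
    have "cbox a b \<inter> {x. x \<bullet> axis i 1 \<le> m} = cbox a (\<chi> j. if j = i then m else b $ j)"
      and "cbox a b \<inter> {x. x \<bullet> axis i 1 \<ge> m} = cbox (\<chi> j. if j = i then m else a $ j) b"
      using that interval_split_cart[where a = a and b = b and k = i and c = m]
      by (simp_all add: interval_cbox_cart inner_axis min_absorb2 max_absorb2 cong: if_cong)
    then show ?thesis
      using integral_split[OF int, of "axis i 1" a b m] by (simp add: axis_in_Basis_iff)
  qed
  have "cis (w \<bullet> v) * integral (cbox 0 r) ?f = integral (cbox v (r + v)) ?f"
    using shift[of 0 v r] by simp
  \<comment> \<open>The translated box is cut where the \<open>i\<close>-th coordinate is
    \<open>r $ i\<close>. The part beyond moves back by the period \<open>p\<close> and becomes the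
    slab that completes \<open>cbox v r\<close> to \<open>cbox 0 r\<close>.\<close>
  also have "\<dots> = integral (cbox v (\<chi> j. if j = i then r $ i else (r + v) $ j)) ?f
      + integral (cbox (\<chi> j. if j = i then r $ i else v $ j) (r + v)) ?f"
    using h by (intro split) (auto simp: v_def axis_def)
  also have "(\<chi> j. if j = i then r $ i else (r + v) $ j) = r"
    by (auto simp: vec_eq_iff v_def axis_def)
  also have "(\<chi> j. if j = i then r $ i else v $ j) = 0 + p"
    by (auto simp: vec_eq_iff v_def p_def axis_def)
  also have "r + v = r' + p"
    by (auto simp: vec_eq_iff v_def p_def axis_def r'_def)
  also have "integral (cbox (0 + p) (r' + p)) ?f = integral (cbox 0 r') ?f"
    unfolding shift using per by (simp add: p_def inner_axis)
  also have "integral (cbox v r) ?f + integral (cbox 0 r') ?f = integral (cbox 0 r) ?f"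
  proof -
    have "(\<chi> j. if j = i then h else (0 :: real ^ 'n) $ j) = v"
      by (auto simp: vec_eq_iff v_def axis_def)
    then show ?thesis
      using split[of 0 h r] h by (simp add: r'_def)
  qed
  finally have "(1 - cis (w \<bullet> v)) * integral (cbox 0 r) ?f = 0"
    by (simp add: algebra_simps)
  moreover have "cis (w \<bullet> v) = - 1"
    using wi by (cases "w $ i > 0") (auto simp: v_def h_def inner_axis complex_eq_iff)
  ultimately show ?thesis by simp
qed

text \<open>Orthogonality. If \<open>k\<close> and \<open>l\<close> differ in coordinate
  \<open>i\<close>, the frequency difference there times \<open>r $ i\<close> is a nonzero multiple
  of \<open>2 * pi\<close>, so the half-period translation fits in the box.\<close>

lemma integral_cis_freq_mult_fourier_mode:
  fixes r :: "real ^ 'n"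
  assumes r: "\<And>i. 0 < r $ i"
  shows "integral (cbox 0 r) (\<lambda>x. cis (freq r k \<bullet> x) * fourier_mode r l x)
       = (if k = l then of_real (\<Prod>i\<in>UNIV. r $ i) else 0)"
proof -
  have eq: "cis (freq r k \<bullet> x) * fourier_mode r l x = cis ((freq r k - freq r l) \<bullet> x)" for x
    by (simp add: fourier_mode_def cis_mult inner_diff_left)
  show ?thesis
  proof (cases "k = l")
    case True
    have "cbox 0 r \<noteq> {}"
      using r by (auto simp: interval_ne_empty_cart less_imp_le)
    then show ?thesis
      unfolding eq using True by (simp add: content_cbox_cart scaleR_conv_of_real)
  next
    case False
    then obtain i where i: "k $ i \<noteq> l $ i" by (auto simp: vec_eq_iff)
    define m where "m = k $ i - l $ i"
    have m: "(freq r k - freq r l) $ i * r $ i = 2 * pi * of_int m"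
      using r[of i] by (simp add: freq_def m_def field_simps)
    have "\<bar>m\<bar> \<ge> 1" using i by (simp add: m_def)
    then have "\<bar>real_of_int m\<bar> \<ge> 1" by linarith
    moreover have "\<bar>(freq r k - freq r l) $ i\<bar> * r $ i = 2 * pi * \<bar>real_of_int m\<bar>"
      using arg_cong[OF m, of abs] r[of i] by (simp add: abs_mult)
    ultimately have "\<bar>(freq r k - freq r l) $ i\<bar> * r $ i > pi"
      using pi_gt_zero by (smt (verit) mult_le_cancel_left1 mult_less_cancel_left2)
    moreover have "cis ((freq r k - freq r l) $ i * r $ i) = 1"
      unfolding m by (rule cis_multiple_2pi) simp
    ultimately show ?thesis
      unfolding eq using False integral_cis_inner_eq_0[of "freq r k - freq r l" i r] by simp
  qed
qed

lemma fourier_coeff_fourier_mode: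
  "fourier_coeff r h k = h (fourier_mode r k) / of_real (\<Prod>i\<in>UNIV. r $ i)"
  by (simp add: fourier_coeff_def fourier_mode_def)

text \<open>By orthogonality only the term \<open>k\<close> of the series survives, and the volume
  cancels the normalisation in \<open>fourier_coeff\<close>.\<close>

lemma nonlocal_fourier_mode:
  fixes r :: "real ^ 'n"
  assumes r: "\<And>i. 0 < r $ i"
  shows "nonlocal r \<delta> \<beta> J (fourier_mode r k) =
    of_real (multiplier \<delta> \<beta> (freq r k)) * J (fourier_mode r k)"
proof -
  let ?P = "of_real (\<Prod>i\<in>UNIV. r $ i) :: complex"
  have "?P \<noteq> 0" using r by (simp add: less_imp_neq[symmetric])
  have "nonlocal r \<delta> \<beta> J (fourier_mode r k) =
    (\<Sum>\<^sub>\<infinity>l\<in>{k}. of_real (multiplier \<delta> \<beta> (freq r l)) * fourier_coeff r J l * ?P)"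
    unfolding nonlocal_def integral_cis_freq_mult_fourier_mode[OF r]
    by (rule infsum_cong_neutral) auto
  then show ?thesis
    using \<open>?P \<noteq> 0\<close> by (simp add: fourier_coeff_fourier_mode del: of_real_prod)
qed

lemma distr_laplacian_fourier_mode:
  fixes r :: "real ^ 'n"
  assumes "\<And>i. 0 < r $ i" "periodic_distribution r h"
  shows "distr_laplacian h (fourier_mode r k) = of_real (- (norm (freq r k))\<^sup>2) * h (fourier_mode r k)"
proof -
  have "laplacian (fourier_mode r k) = (\<lambda>x. of_real (- (norm (freq r k))\<^sup>2) * fourier_mode r k x)"
    unfolding fourier_mode_eq laplacian_cis_inner by simp
  moreover have "h (\<lambda>x. c * \<phi> x) = c * h \<phi>" if "\<phi> \<in> test_functions r" for c \<phi>
    using assms(2) that unfolding periodic_distribution_def by blast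
  ultimately show ?thesis
    using fourier_mode_test_function[OF assms(1)] unfolding distr_laplacian_def by metis
qed

section \<open>Duhamel's formula\<close>

text \<open>This is the integral of \<open>exp (m * x)\<close> for \<open>x\<close> from 0 to
  \<open>t\<close>; the separate branch is its value at \<open>m = 0\<close>, as occurs for
  \<open>k = 0\<close>.\<close>

definition duhamel :: "real \<Rightarrow> real \<Rightarrow> real" where
  "duhamel t m = (if m = 0 then t else (exp (m * t) - 1) / m)"

text \<open>The integrating factor \<open>exp (- m * t)\<close> makes the difference from the
  explicit solution constant.\<close>

lemma linear_ode_solution_unique:
  fixes y :: "real \<Rightarrow> complex"
  assumes cont: "continuous_on {0..} y" and y0: "y 0 = 0" and t: "0 < t"
    and deriv: "\<And>t. 0 < t \<Longrightarrow> (y has_vector_derivative of_real m * y t + c) (at t)"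
  shows "y t = of_real (duhamel t m) * c"
proof -
  define d where "d t = of_real (duhamel t m) * c" for t
  have d_deriv: "(d has_vector_derivative of_real m * d t + c) (at t)" for t
  proof -
    have "((\<lambda>t. duhamel t m) has_real_derivative m * duhamel t m + 1) (at t)"
      unfolding duhamel_def
      by (cases "m = 0") (auto intro!: derivative_eq_intros)
    then have "(d has_vector_derivative of_real (m * duhamel t m + 1) * c) (at t)"
      unfolding d_def by (intro has_vector_derivative_mult_left has_vector_derivative_of_real)
    then show ?thesis by (simp add: d_def algebra_simps)
  qed
  define z where "z t = exp (- m * t) *\<^sub>R (y t - d t)" for t
  have "z t = 0"
  \<comment> \<open>The equation holds only for positive times, so 0 is the exceptional point, where
    continuity suffices.\<close>
  proof (rule has_derivative_zero_unique_strong_interval[of "{0}" 0 t])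
    have "continuous_on {0..t} d"
      by (intro continuous_at_imp_continuous_on ballI has_vector_derivative_continuous[OF d_deriv])
    then show "continuous_on {0..t} z"
      unfolding z_def by (intro continuous_intros continuous_on_subset[OF cont]) auto
    show "z 0 = 0" by (simp add: z_def d_def duhamel_def y0)
    fix x assume "x \<in> {0..t} - {0}"
    then have "0 < x" by auto
    have "(z has_vector_derivative exp (- m * x) *\<^sub>R ((of_real m * y x + c) - (of_real m * d x + c))
        + (- m * exp (- m * x)) *\<^sub>R (y x - d x)) (at x)"
      unfolding z_def
      by (intro has_vector_derivative_scaleR has_vector_derivative_diff deriv d_deriv \<open>0 < x\<close>)
         (auto intro!: derivative_eq_intros)
    then have "(z has_vector_derivative 0) (at x)"
      by (simp add: algebra_simps scaleR_conv_of_real)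
    then show "(z has_derivative (\<lambda>h. 0)) (at x within {0..t})"
      using has_vector_derivative_at_within by (fastforce simp: has_vector_derivative_def)
  qed (use t in auto)
  then show ?thesis by (simp add: z_def d_def)
qed

lemma duhamel_nonneg: "0 \<le> t \<Longrightarrow> 0 \<le> duhamel t m"
  by (auto simp: duhamel_def divide_nonneg_pos zero_le_divide_iff mult_nonpos_nonneg linorder_neq_iff)

lemma duhamel_le_time:
  assumes "0 \<le> t" "m \<le> 0"
  shows "duhamel t m \<le> t"
proof (cases "m = 0")
  case False
  have "m * t \<le> exp (m * t) - 1" using exp_ge_add_one_self[of "m * t"] by linarith
  with False assms show ?thesis by (simp add: duhamel_def neg_divide_le_eq mult.commute)
qed (simp add: duhamel_def)

lemma duhamel_le_inverse:
  assumes "m < 0"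
  shows "duhamel t m \<le> 1 / (- m)"
  using assms by (simp add: duhamel_def field_simps mult_nonpos_nonneg)

text \<open>A nonzero limit keeps \<open>f\<close> eventually off the exceptional branch of
  \<open>duhamel\<close>.\<close>

lemma tendsto_duhamel:
  assumes "(f \<longlongrightarrow> m) F" "m \<noteq> 0"
  shows "((\<lambda>x. duhamel t (f x)) \<longlongrightarrow> duhamel t m) F"
proof -
  have "((\<lambda>x. (exp (f x * t) - 1) / f x) \<longlongrightarrow> (exp (m * t) - 1) / m) F"
    by (intro tendsto_intros assms)
  moreover have "\<forall>\<^sub>F x in F. f x \<noteq> 0"
    using assms by (rule tendsto_imp_eventually_ne)
  ultimately show ?thesis
    using assms(2) by (auto simp: duhamel_def elim!: Lim_transform_eventually eventually_mono)
qed

text \<open>Tested with one mode, the equation is a scalar linear one. Assumption \<open>A\<close>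
  captures the diagonal action shared by the local and the nonlocal operator.\<close>

lemma fourier_coeff_diffusion_solution:
  fixes r :: "real ^ 'n"
  assumes r: "\<And>i. 0 < r $ i" and sol: "diffusion_solution r A b u" and t: "0 < t"
    and A: "\<And>h. periodic_distribution r h \<Longrightarrow> A h (fourier_mode r k) = of_real m * h (fourier_mode r k)"
  shows "fourier_coeff r (u t) k = of_real (duhamel t m) * fourier_coeff r b k"
proof -
  note e = fourier_mode_test_function[OF r, of k]
  have "u t (fourier_mode r k) = of_real (duhamel t m) * b (fourier_mode r k)"
    by (rule linear_ode_solution_unique) (use sol e t A in \<open>auto simp: diffusion_solution_def\<close>)
  then show ?thesis by (simp add: fourier_coeff_fourier_mode)
qed

section \<open>Dominated convergence in Sobolev spaces\<close>

text \<open>The Weierstrass test makes the finite partial sums converge uniformly in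
  \<open>x\<close>, which allows the limits to be exchanged.\<close>

lemma infsum_tendsto_0_dominated:
  fixes f :: "'b \<Rightarrow> 'a \<Rightarrow> real"
  assumes g: "g summable_on UNIV"
    and bound: "\<forall>\<^sub>F x in F. \<forall>k. \<bar>f x k\<bar> \<le> g k"
    and lim: "\<And>k. ((\<lambda>x. f x k) \<longlongrightarrow> 0) F"
  shows "((\<lambda>x. \<Sum>\<^sub>\<infinity>k. f x k) \<longlongrightarrow> 0) F"
proof (rule swap_uniform_limit')
  show "uniform_limit {x. \<forall>k. \<bar>f x k\<bar> \<le> g k} (\<lambda>X x. \<Sum>k\<in>X. f x k) (\<lambda>x. \<Sum>\<^sub>\<infinity>k. f x k)
      (finite_subsets_at_top UNIV)"
    using g by (intro Weierstrass_m_test_general) auto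
  show "\<forall>\<^sub>F X in finite_subsets_at_top UNIV. ((\<lambda>x. \<Sum>k\<in>X. f x k) \<longlongrightarrow> 0) F"
    using tendsto_sum[where f = "\<lambda>k x. f x k" and a = "\<lambda>_. 0" and F = F] lim by simp
qed (use bound in auto)

text \<open>The majorant passes to the limit \<open>h\<close>, so it gives membership in the space
  for both \<open>f x\<close> and \<open>h\<close>, and \<open>4 * g\<close> dominates the
  differences.\<close>

lemma sobolev_tendsto_dominated:
  fixes r :: "real ^ 'n" and f :: "'a \<Rightarrow> 'n functional"
  assumes "F \<noteq> bot"
    and f: "\<forall>\<^sub>F x in F. periodic_distribution r (f x)" and h: "periodic_distribution r h"
    and lim: "\<And>k. ((\<lambda>x. fourier_coeff r (f x) k) \<longlongrightarrow> fourier_coeff r h k) F"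
    and g: "g summable_on UNIV" and bound: "\<forall>\<^sub>F x in F. \<forall>k. sobolev_term r s (f x) k \<le> g k"
  shows "sobolev_tendsto r s f h F"
proof -
  have term_lim: "((\<lambda>x. sobolev_term r s (f x) k) \<longlongrightarrow> sobolev_term r s h k) F" for k
    unfolding sobolev_term_def by (intro tendsto_intros lim)
  have nonneg: "0 \<le> sobolev_term r s j k" for j k
    by (simp add: sobolev_term_def)
  have h_bound: "sobolev_term r s h k \<le> g k" for k
    by (rule tendsto_upperbound[OF term_lim]) (use bound assms(1) in \<open>auto elim: eventually_mono\<close>)
  have summable: "sobolev_term r s j summable_on UNIV" if "\<And>k. sobolev_term r s j k \<le> g k" for j
    using g by (rule summable_on_comparison_test) (use that nonneg in auto)
  have coeff: "fourier_coeff r (\<lambda>\<phi>. f x \<phi> - h \<phi>) k = fourier_coeff r (f x) k - fourier_coeff r h k" for x k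
    by (simp add: fourier_coeff_def diff_divide_distrib)
  have diff_bound: "sobolev_term r s (\<lambda>\<phi>. f x \<phi> - h \<phi>) k \<le> 4 * g k"
    if "sobolev_term r s (f x) k \<le> g k" for x k
  proof -
    \<comment> \<open>Applied to two coefficients whose weighted squares are at most
      \<open>g k\<close>, this yields the factor 4.\<close>
    have "(norm (a - b))\<^sup>2 \<le> 2 * (norm a)\<^sup>2 + 2 * (norm b)\<^sup>2" for a b :: complex
    proof -
      have "(norm (a - b))\<^sup>2 \<le> (norm a + norm b)\<^sup>2"
        by (intro power_mono norm_triangle_ineq4) auto
      also have "\<dots> \<le> 2 * (norm a)\<^sup>2 + 2 * (norm b)\<^sup>2"
        using zero_le_power2[of "norm a - norm b"] by (simp add: power2_eq_square algebra_simps)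
      finally show ?thesis .
    qed
    then have "sobolev_term r s (\<lambda>\<phi>. f x \<phi> - h \<phi>) k \<le> 2 * sobolev_term r s (f x) k + 2 * sobolev_term r s h k"
      unfolding sobolev_term_def coeff mult.left_commute[of 2] distrib_left[symmetric]
      by (intro mult_left_mono) auto
    then show ?thesis using that h_bound[of k] by simp
  qed
  have "((\<lambda>x. \<Sum>\<^sub>\<infinity>k. sobolev_term r s (\<lambda>\<phi>. f x \<phi> - h \<phi>) k) \<longlongrightarrow> 0) F"
  proof (rule infsum_tendsto_0_dominated)
    show "(\<lambda>k. 4 * g k) summable_on UNIV" using g by (rule summable_on_cmult_right)
    show "\<forall>\<^sub>F x in F. \<forall>k. \<bar>sobolev_term r s (\<lambda>\<phi>. f x \<phi> - h \<phi>) k\<bar> \<le> 4 * g k"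
      using bound by eventually_elim (simp add: nonneg diff_bound)
    fix k
    have "((\<lambda>x. fourier_coeff r (f x) k - fourier_coeff r h k) \<longlongrightarrow> 0) F"
      using lim[of k] by (rule LIM_zero)
    from tendsto_mult_left[OF tendsto_power[OF tendsto_norm[OF this]]]
    show "((\<lambda>x. sobolev_term r s (\<lambda>\<phi>. f x \<phi> - h \<phi>) k) \<longlongrightarrow> 0) F"
      unfolding sobolev_term_def coeff by (rule tendsto_eq_rhs) simp
  qed
  then have "((\<lambda>x. sobolev_norm r s (\<lambda>\<phi>. f x \<phi> - h \<phi>)) \<longlongrightarrow> 0) F"
    unfolding sobolev_norm_def using tendsto_real_sqrt by fastforce
  moreover have "\<forall>\<^sub>F x in F. f x \<in> sobolev r s"
    using f bound by eventually_elim (simp add: sobolev_def summable)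
  ultimately show ?thesis
    using h summable[OF h_bound] by (simp add: sobolev_tendsto_def sobolev_def)
qed

section \<open>Bounds for the multiplier and convergence\<close>

lemma multiplier_eq:
  fixes \<nu> :: "real ^ 'n" and \<beta> :: real
  defines "a \<equiv> (real CARD('n) + 2 - \<beta>) / 2" and "c \<equiv> real CARD('n) / 2"
  shows "multiplier \<delta> \<beta> \<nu> =
    - (norm \<nu>)\<^sup>2 * hypergeometric [1, a] [2, c + 1, a + 1] (- ((norm \<nu>)\<^sup>2 * \<delta>\<^sup>2 / 4))"
proof -
  have *: "(real CARD('n) + 2) / 2 = c + 1" "(real CARD('n) + 4 - \<beta>) / 2 = a + 1"
    by (simp_all add: a_def c_def field_simps)
  show ?thesis unfolding multiplier_def Let_def * a_def[symmetric] by simp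
qed

text \<open>The dimension is at least 1, so \<open>c = n / 2\<close> meets the condition of the
  Bessel bound.\<close>

lemma CARD_half_ge: "1 / 2 \<le> real CARD('n::finite) / 2"
  by (simp add: Suc_leI)

text \<open>The series bound is taken at
  \<open>y = (norm \<nu>)\<^sup>2 * \<delta>\<^sup>2 / 4\<close>. The constant is chosen before
  \<delta> and \<nu>, hence is uniform in both.\<close>

lemma multiplier_upper_bound:
  assumes "\<beta> \<le> real CARD('n) + 2"
  obtains \<kappa> where "0 < \<kappa>"
    "\<And>\<delta> (\<nu> :: real ^ 'n). multiplier \<delta> \<beta> \<nu> \<le>
       - (\<kappa> * (norm \<nu>)\<^sup>2 * (1 + (norm \<nu>)\<^sup>2 * \<delta>\<^sup>2 / 4) powr (- ((real CARD('n) + 2 - \<beta>) / 2)))"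
proof -
  define a where "a = (real CARD('n) + 2 - \<beta>) / 2"
  have a: "0 \<le> a" using assms by (simp add: a_def)
  obtain \<kappa> where "0 < \<kappa>" and bound: "\<And>y. 0 \<le> y \<Longrightarrow>
      \<kappa> * (1 + y) powr (- a) \<le> hypergeometric [1, a] [2, real CARD('n) / 2 + 1, a + 1] (- y)"
    using multiplier_series_lower_bound[OF a CARD_half_ge[where 'n = 'n]] by blast
  show ?thesis
  proof
    show "0 < \<kappa>" by fact
    fix \<delta> and \<nu> :: "real ^ 'n"
    have "(norm \<nu>)\<^sup>2 * (\<kappa> * (1 + (norm \<nu>)\<^sup>2 * \<delta>\<^sup>2 / 4) powr (- a)) \<le> - multiplier \<delta> \<beta> \<nu>"
      unfolding multiplier_eq a_def[symmetric] minus_mult_left[symmetric] minus_minus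
      by (intro mult_left_mono bound) auto
    then show "multiplier \<delta> \<beta> \<nu> \<le>
      - (\<kappa> * (norm \<nu>)\<^sup>2 * (1 + (norm \<nu>)\<^sup>2 * \<delta>\<^sup>2 / 4) powr (- ((real CARD('n) + 2 - \<beta>) / 2)))"
      by (simp add: a_def[symmetric] mult_ac)
  qed
qed

lemma multiplier_nonpos:
  fixes \<nu> :: "real ^ 'n"
  assumes "\<beta> \<le> real CARD('n) + 2"
  shows "multiplier \<delta> \<beta> \<nu> \<le> 0"
proof -
  obtain \<kappa> where "0 < \<kappa>" and "multiplier \<delta> \<beta> \<nu> \<le>
       - (\<kappa> * (norm \<nu>)\<^sup>2 * (1 + (norm \<nu>)\<^sup>2 * \<delta>\<^sup>2 / 4) powr (- ((real CARD('n) + 2 - \<beta>) / 2)))"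
    using multiplier_upper_bound[OF assms] by metis
  moreover have "0 \<le> \<kappa> * (norm \<nu>)\<^sup>2 * (1 + (norm \<nu>)\<^sup>2 * \<delta>\<^sup>2 / 4) powr (- ((real CARD('n) + 2 - \<beta>) / 2))"
    using \<open>0 < \<kappa>\<close> by simp
  ultimately show ?thesis by linarith
qed

lemma multiplier_tendsto_local:
  fixes \<nu> :: "real ^ 'n"
  assumes "\<beta> \<le> real CARD('n) + 2"
  shows "((\<lambda>\<delta>. multiplier \<delta> \<beta> \<nu>) \<longlongrightarrow> - (norm \<nu>)\<^sup>2) (at_right 0)"
proof -
  define a where "a = (real CARD('n) + 2 - \<beta>) / 2"
  let ?F = "hypergeometric [1, a] [2, real CARD('n) / 2 + 1, a + 1]"
  obtain F' where "\<And>z. (?F has_real_derivative F' z) (at z)"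
    by (rule multiplier_series_derivative[of a "real CARD('n) / 2"]) (use assms in \<open>auto simp: a_def\<close>)
  then have "isCont ?F 0" by (rule DERIV_isCont)
  moreover have "((\<lambda>\<delta>. - ((norm \<nu>)\<^sup>2 * \<delta>\<^sup>2 / 4)) \<longlongrightarrow> 0) (at_right 0)"
    by (auto intro!: tendsto_eq_intros)
  ultimately have "((\<lambda>\<delta>. ?F (- ((norm \<nu>)\<^sup>2 * \<delta>\<^sup>2 / 4))) \<longlongrightarrow> 1) (at_right 0)"
    using isCont_tendsto_compose[of 0 ?F] by (metis hypergeometric_at_0)
  then show ?thesis
    unfolding multiplier_eq a_def[symmetric] by (auto intro!: tendsto_eq_intros)
qed

section \<open>Uniform decay of the Duhamel factor\<close>

lemma norm_freq_lower_bound: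
  fixes r :: "real ^ 'n"
  assumes r: "\<And>i. 0 < r $ i"
  obtains c where "0 < c"
    "\<And>k. k \<noteq> 0 \<Longrightarrow> c * (1 + (norm (\<chi> i. real_of_int (k $ i)))\<^sup>2) \<le> (norm (freq r k))\<^sup>2"
proof -
  define R where "R = (\<Sum>i\<in>UNIV. r $ i)"
  have rR: "r $ i \<le> R" for i
    unfolding R_def by (rule member_le_sum) (auto intro: less_imp_le r)
  have R: "0 < R" using rR r by (meson less_le_trans)
  have norm_sq: "(norm x)\<^sup>2 = (\<Sum>i\<in>UNIV. (x $ i)\<^sup>2)" for x :: "real ^ 'n"
    unfolding power2_norm_eq_inner inner_vec_def by (simp add: power2_eq_square)
  show ?thesis
  proof
    \<comment> \<open>\<open>R\<close> bounds every side length. The 1/2 absorbs the summand 1: a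
      nonzero integer vector has norm at least 1.\<close>
    show "0 < (2 * pi / R)\<^sup>2 / 2" using R by simp
    fix k :: "int ^ 'n" assume "k \<noteq> 0"
    let ?k = "\<chi> i. real_of_int (k $ i)"
    obtain i where "k $ i \<noteq> 0" using \<open>k \<noteq> 0\<close> by (auto simp: vec_eq_iff)
    then have "1 \<le> (k $ i)\<^sup>2" by (simp add: int_one_le_iff_zero_less)
    then have "1 \<le> (real_of_int (k $ i))\<^sup>2"
      by (metis of_int_1_le_iff of_int_power)
    also have "\<dots> \<le> (norm ?k)\<^sup>2"
      unfolding norm_sq using member_le_sum[of i UNIV "\<lambda>i. (?k $ i)\<^sup>2"] by simp
    finally have "(2 * pi / R)\<^sup>2 / 2 * (1 + (norm ?k)\<^sup>2) \<le> (2 * pi / R)\<^sup>2 / 2 * (2 * (norm ?k)\<^sup>2)"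
      by (intro mult_left_mono) auto
    also have "\<dots> = (\<Sum>i\<in>UNIV. (2 * pi / R)\<^sup>2 * (?k $ i)\<^sup>2)"
      by (simp add: norm_sq sum_distrib_left)
    also have "\<dots> \<le> (\<Sum>i\<in>UNIV. (2 * pi / r $ i)\<^sup>2 * (?k $ i)\<^sup>2)"
      using r rR R by (intro sum_mono mult_right_mono power_mono divide_left_mono) auto
    also have "\<dots> = (norm (freq r k))\<^sup>2"
      by (simp add: norm_sq freq_def power_mult_distrib power_divide)
    finally show "(2 * pi / R)\<^sup>2 / 2 * (1 + (norm ?k)\<^sup>2) \<le> (norm (freq r k))\<^sup>2" .
  qed
qed

text \<open>The weight has exponent \<open>1 - a\<close>, which after squaring is a gain of \<beta>
  - n in the Sobolev order. The multiplier grows at least like this weight, uniformly for \<delta> <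
  2.\<close>

lemma duhamel_multiplier_bound:
  fixes r :: "real ^ 'n"
  assumes r: "\<And>i. 0 < r $ i" and \<beta>: "real CARD('n) \<le> \<beta>" "\<beta> \<le> real CARD('n) + 2" and t: "0 < t"
  obtains C where "\<And>\<delta> k. 0 < \<delta> \<Longrightarrow> \<delta> < 2 \<Longrightarrow>
    duhamel t (multiplier \<delta> \<beta> (freq r k)) *
      (1 + (norm (\<chi> i. real_of_int (k $ i)))\<^sup>2) powr ((\<beta> - real CARD('n)) / 2) \<le> C"
proof -
  define a where "a = (real CARD('n) + 2 - \<beta>) / 2"
  have a: "0 \<le> a" "a \<le> 1" and a': "(\<beta> - real CARD('n)) / 2 = 1 - a"
    using \<beta> by (auto simp: a_def field_simps)
  obtain \<kappa> where \<kappa>: "0 < \<kappa>" and ub: "\<And>\<delta> (\<nu> :: real ^ 'n). multiplier \<delta> \<beta> \<nu> \<le>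
      - (\<kappa> * (norm \<nu>)\<^sup>2 * (1 + (norm \<nu>)\<^sup>2 * \<delta>\<^sup>2 / 4) powr (- a))"
    unfolding a_def using multiplier_upper_bound[OF \<beta>(2)] by blast
  obtain c where c: "0 < c" and freq: "\<And>k. k \<noteq> 0 \<Longrightarrow>
      c * (1 + (norm (\<chi> i. real_of_int (k $ i)))\<^sup>2) \<le> (norm (freq r k))\<^sup>2"
    using norm_freq_lower_bound[OF r] by blast
  \<comment> \<open>The factors come from the multiplier bound, from comparing \<open>N\<close> with
    \<open>1 + N\<close> when \<open>N \<ge> c\<close>, and from
    \<open>N \<ge> c * W\<close>.\<close>
  define \<epsilon> where "\<epsilon> = \<kappa> * (c / (1 + c)) * c powr (1 - a)"
  have \<epsilon>: "0 < \<epsilon>" using \<kappa> c by (simp add: \<epsilon>_def)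
  show ?thesis
  proof
    fix \<delta> :: real and k
    assume \<delta>: "0 < \<delta>" "\<delta> < 2"
    let ?m = "multiplier \<delta> \<beta> (freq r k)"
    define W where "W = 1 + (norm (\<chi> i. real_of_int (k $ i)))\<^sup>2"
    have W: "1 \<le> W" by (simp add: W_def)
    have "duhamel t ?m * W powr (1 - a) \<le> max t (1 / \<epsilon>)"
    proof (cases "k = 0")
      \<comment> \<open>At \<open>k = 0\<close> the weight is 1 and the bound by \<open>t\<close> is
        used.\<close>
      case True
      then have "W = 1" by (simp add: W_def norm_eq_zero[THEN iffD2] vec_eq_iff)
      then show ?thesis
        using duhamel_le_time[of t ?m] multiplier_nonpos[OF \<beta>(2)] t by (simp add: le_max_iff_disj)
    next
      case False
      define N where "N = (norm (freq r k))\<^sup>2"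
      have cW: "c * W \<le> N" using freq[OF False] by (simp add: N_def W_def)
      have cN: "c \<le> N" using cW mult_left_mono[OF W, of c] c by linarith
      have N: "0 < N" using cN c by simp
      \<comment> \<open>The threshold 2 is chosen so that
        \<open>\<delta>\<^sup>2 / 4 \<le> 1\<close>, which removes \<delta> from the
        estimate.\<close>
      have "\<delta>\<^sup>2 \<le> 2\<^sup>2" using \<delta> by (intro power_mono) auto
      then have "N * \<delta>\<^sup>2 \<le> N * 4" using N by (intro mult_left_mono) auto
      then have "1 + N * \<delta>\<^sup>2 / 4 \<le> 1 + N" by simp
      then have 1: "(1 + N) powr (- a) \<le> (1 + N * \<delta>\<^sup>2 / 4) powr (- a)"
        using a N by (intro powr_mono2') (auto intro: add_pos_nonneg)
      have 2: "c / (1 + c) * (1 + N) \<le> N"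
        using cN c by (simp add: field_simps)
      have "\<epsilon> * W powr (1 - a) = \<kappa> * (c / (1 + c)) * (c * W) powr (1 - a)"
        using c W by (simp add: \<epsilon>_def powr_mult)
      also have "\<dots> \<le> \<kappa> * (c / (1 + c)) * (1 + N) powr (1 - a)"
        using \<kappa> c a W cW by (intro mult_left_mono powr_mono2) auto
      also have "\<dots> = \<kappa> * (c / (1 + c) * (1 + N)) * (1 + N) powr (- a)"
        using N by (simp add: powr_diff powr_minus field_simps)
      also have "\<dots> \<le> \<kappa> * N * (1 + N * \<delta>\<^sup>2 / 4) powr (- a)"
        using 1 2 \<kappa> N c by (intro mult_mono) auto
      also have "\<dots> \<le> - ?m"
        using ub[of \<delta> "freq r k"] by (simp add: N_def)
      finally have m: "\<epsilon> * W powr (1 - a) \<le> - ?m" .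
      have pos: "0 < \<epsilon> * W powr (1 - a)" using \<epsilon> W by simp
      then have "duhamel t ?m \<le> 1 / (- ?m)" using m by (intro duhamel_le_inverse) linarith
      also have "\<dots> \<le> 1 / (\<epsilon> * W powr (1 - a))"
        using m pos by (intro divide_left_mono mult_pos_pos[of "- ?m"]) linarith+
      finally have "duhamel t ?m * W powr (1 - a) \<le> 1 / \<epsilon>"
        using pos \<epsilon> by (simp add: field_simps)
      then show ?thesis by simp
    qed
    then show "duhamel t ?m * (1 + (norm (\<chi> i. real_of_int (k $ i)))\<^sup>2) powr ((\<beta> - real CARD('n)) / 2)
        \<le> max t (1 / \<epsilon>)"
      unfolding W_def a' .
  qed
qed

section \<open>Convergence of the solutions\<close>

lemma fourier_coeff_nonlocal_tendsto:
  fixes r :: "real ^ 'n"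
  assumes r: "\<And>i. 0 < r $ i" and \<beta>: "\<beta> \<le> real CARD('n) + 2" and t: "0 < t"
    and u: "diffusion_solution r distr_laplacian b u"
    and v: "\<And>\<delta>. 0 < \<delta> \<Longrightarrow> diffusion_solution r (nonlocal r \<delta> \<beta>) b (v \<delta>)"
  shows "((\<lambda>\<delta>. fourier_coeff r (v \<delta> t) k) \<longlongrightarrow> fourier_coeff r (u t) k) (at_right 0)"
proof -
  have "((\<lambda>\<delta>. duhamel t (multiplier \<delta> \<beta> (freq r k))) \<longlongrightarrow> duhamel t (- (norm (freq r k))\<^sup>2)) (at_right 0)"
  proof (cases "freq r k = 0")
    \<comment> \<open>At zero frequency the multiplier is 0 for every \<delta>, so the expression is
      constant; \<open>tendsto_duhamel\<close> handles nonzero limits.\<close>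
    case True
    then show ?thesis by (simp add: multiplier_def)
  next
    case False
    then show ?thesis by (intro tendsto_duhamel multiplier_tendsto_local \<beta>) auto
  qed
  then have "((\<lambda>\<delta>. of_real (duhamel t (multiplier \<delta> \<beta> (freq r k))) * fourier_coeff r b k)
      \<longlongrightarrow> of_real (duhamel t (- (norm (freq r k))\<^sup>2)) * fourier_coeff r b k) (at_right 0)"
    by (intro tendsto_intros)
  moreover have "\<forall>\<^sub>F \<delta> in at_right 0.
      of_real (duhamel t (multiplier \<delta> \<beta> (freq r k))) * fourier_coeff r b k = fourier_coeff r (v \<delta> t) k"
    using eventually_at_right_less[of 0]
    by eventually_elim
       (rule fourier_coeff_diffusion_solution[OF r v t nonlocal_fourier_mode[OF r], symmetric])
  moreover have "of_real (duhamel t (- (norm (freq r k))\<^sup>2)) * fourier_coeff r b k = fourier_coeff r (u t) k"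
    by (rule fourier_coeff_diffusion_solution[OF r u t distr_laplacian_fourier_mode[OF r], symmetric])
  ultimately show ?thesis
    using Lim_transform_eventually by fastforce
qed

text \<open>Here \<sigma> is the gain in Sobolev order. Squaring the assumed bound gives the
  summable majorant \<open>C\<^sup>2 * sobolev_term r s b k\<close>.\<close>

lemma sobolev_tendsto_of_duhamel_bound:
  fixes r :: "real ^ 'n"
  assumes r: "\<And>i. 0 < r $ i" and \<beta>: "\<beta> \<le> real CARD('n) + 2" and t: "0 < t"
    and b: "b \<in> sobolev r s"
    and u: "diffusion_solution r distr_laplacian b u"
    and v: "\<And>\<delta>. 0 < \<delta> \<Longrightarrow> diffusion_solution r (nonlocal r \<delta> \<beta>) b (v \<delta>)"
    and bound: "\<And>\<delta> k. 0 < \<delta> \<Longrightarrow> \<delta> < 2 \<Longrightarrow>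
      duhamel t (multiplier \<delta> \<beta> (freq r k)) *
        (1 + (norm (\<chi> i. real_of_int (k $ i)))\<^sup>2) powr (\<sigma> / 2) \<le> C"
  shows "sobolev_tendsto r (s + \<sigma>) (\<lambda>\<delta>. v \<delta> t) (u t) (at_right 0)"
proof (rule sobolev_tendsto_dominated)
  have pos: "\<forall>\<^sub>F \<delta> in at_right 0. 0 < (\<delta>::real)"
    by (rule eventually_at_right_less)
  have small: "\<forall>\<^sub>F \<delta> in at_right 0. \<delta> < (2::real)"
    by (rule order_tendstoD[OF tendsto_ident_at]) simp
  show "\<forall>\<^sub>F \<delta> in at_right 0. periodic_distribution r (v \<delta> t)"
    using pos by eventually_elim (use v t in \<open>auto simp: diffusion_solution_def\<close>)
  show "periodic_distribution r (u t)"
    using u t by (auto simp: diffusion_solution_def)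
  show "((\<lambda>\<delta>. fourier_coeff r (v \<delta> t) k) \<longlongrightarrow> fourier_coeff r (u t) k) (at_right 0)" for k
    by (rule fourier_coeff_nonlocal_tendsto[OF r \<beta> t u v])
  show "(\<lambda>k. C\<^sup>2 * sobolev_term r s b k) summable_on UNIV"
    using b by (intro summable_on_cmult_right) (simp add: sobolev_def)
  show "\<forall>\<^sub>F \<delta> in at_right 0. \<forall>k. sobolev_term r (s + \<sigma>) (v \<delta> t) k \<le> C\<^sup>2 * sobolev_term r s b k"
    using pos small
  proof eventually_elim
    case (elim \<delta>)
    show ?case
    proof
      fix k
      let ?d = "duhamel t (multiplier \<delta> \<beta> (freq r k))"
      define W where "W = 1 + (norm (\<chi> i. real_of_int (k $ i)))\<^sup>2"
      have "0 < W" by (simp add: W_def add_pos_nonneg)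
      have "fourier_coeff r (v \<delta> t) k = of_real ?d * fourier_coeff r b k"
        by (rule fourier_coeff_diffusion_solution[OF r v t nonlocal_fourier_mode[OF r]]) (use elim in auto)
      then have "sobolev_term r (s + \<sigma>) (v \<delta> t) k = (?d * W powr (\<sigma> / 2))\<^sup>2 * sobolev_term r s b k"
        using \<open>0 < W\<close>
        by (simp add: sobolev_term_def W_def[symmetric] norm_mult power_mult_distrib powr_add
            powr_power mult_ac)
      also have "\<dots> \<le> C\<^sup>2 * sobolev_term r s b k"
        using bound[OF elim, of k] duhamel_nonneg[of t] t
        by (intro mult_right_mono power_mono) (auto simp: sobolev_term_def W_def)
      finally show "sobolev_term r (s + \<sigma>) (v \<delta> t) k \<le> C\<^sup>2 * sobolev_term r s b k" .
    qed
  qed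
qed simp

theorem theorem12:
  fixes r :: "real ^ 'n" and s \<beta> t :: real
    and b :: "'n functional"
    and u :: "real \<Rightarrow> 'n functional"
    and u_nonlocal :: "real \<Rightarrow> real \<Rightarrow> 'n functional"
  assumes "\<And>i. 0 < r $ i"
    and "b \<in> sobolev r s"
    and "diffusion_solution r distr_laplacian b u"
    and "\<And>\<delta>. 0 < \<delta> \<Longrightarrow> diffusion_solution r (nonlocal r \<delta> \<beta>) b (u_nonlocal \<delta>)"
    and "0 < t"
  shows "(\<beta> \<le> real CARD('n) \<longrightarrow>
            sobolev_tendsto r s (\<lambda>\<delta>. u_nonlocal \<delta> t) (u t) (at_right 0)) \<and>
         (real CARD('n) < \<beta> \<and> \<beta> \<le> real CARD('n) + 2 \<longrightarrow>
            sobolev_tendsto r (s + \<beta> - real CARD('n)) (\<lambda>\<delta>. u_nonlocal \<delta> t) (u t) (at_right 0))"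
proof (intro conjI impI)
  assume \<beta>: "\<beta> \<le> real CARD('n)"
  \<comment> \<open>The case of gain 0: the weight is 1, and \<open>t\<close> serves as the
    constant.\<close>
  have "duhamel t (multiplier \<delta> \<beta> (freq r k)) *
      (1 + (norm (\<chi> i. real_of_int (k $ i)))\<^sup>2) powr (0 / 2) \<le> t" for \<delta> k
  proof -
    have "0 < 1 + (norm (\<chi> i. real_of_int (k $ i)))\<^sup>2" by (simp add: add_pos_nonneg)
    then show ?thesis
      using duhamel_le_time[of t "multiplier \<delta> \<beta> (freq r k)"] multiplier_nonpos[of \<beta> \<delta> "freq r k"]
        \<beta> \<open>0 < t\<close> by simp
  qed
  then have "sobolev_tendsto r (s + 0) (\<lambda>\<delta>. u_nonlocal \<delta> t) (u t) (at_right 0)"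
    using \<beta> by (intro sobolev_tendsto_of_duhamel_bound[where b = b and \<beta> = \<beta> and C = t] assms) auto
  then show "sobolev_tendsto r s (\<lambda>\<delta>. u_nonlocal \<delta> t) (u t) (at_right 0)" by simp
next
  assume "real CARD('n) < \<beta> \<and> \<beta> \<le> real CARD('n) + 2"
  then have \<beta>: "real CARD('n) \<le> \<beta>" "\<beta> \<le> real CARD('n) + 2" by auto
  \<comment> \<open>The gain is now \<beta> - n.\<close>
  obtain C where "\<And>\<delta> k. 0 < \<delta> \<Longrightarrow> \<delta> < 2 \<Longrightarrow> duhamel t (multiplier \<delta> \<beta> (freq r k)) *
      (1 + (norm (\<chi> i. real_of_int (k $ i)))\<^sup>2) powr ((\<beta> - real CARD('n)) / 2) \<le> C"
    using duhamel_multiplier_bound[OF assms(1) \<beta> \<open>0 < t\<close>] by blast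
  then have "sobolev_tendsto r (s + (\<beta> - real CARD('n))) (\<lambda>\<delta>. u_nonlocal \<delta> t) (u t) (at_right 0)"
    using \<beta> by (intro sobolev_tendsto_of_duhamel_bound[where b = b and \<beta> = \<beta> and C = C] assms) auto
  then show "sobolev_tendsto r (s + \<beta> - real CARD('n)) (\<lambda>\<delta>. u_nonlocal \<delta> t) (u t) (at_right 0)"
    by (simp add: algebra_simps)
qed

end
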